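(* Let $\mu,\hat\mu\in\mathbb{R}^n$ be positive stationary distributions, that is, entrywise positive vectors with entries summing to one. Let $P$ and $\hat P$ be $n\times n$ permutation matrices that reorder the elements of $\mu$ and $\hat\mu$, respectively, so that the elements of the permuted vectors $P\mu$ and $\hat P\hat\mu$ each form a non-decreasing sequence. Then $$\Big[\min_i \frac{(P\mu)_i}{(\hat P\hat\mu)_i},\ \max_i\frac{(P\mu)_i}{(\hat P\hat\mu)_i}\Big]\subset\Big[\min_i\frac{\mu_i}{\hat\mu_i},\ \max_i\frac{\mu_i}{\hat\mu_i}\Big].$$
   Context: The symbol $\subset$ denotes (not necessarily strict) inclusion. *)

theory Defs
  imports "Jordan_Normal_Form.Matrix"
begin

definition positive_distribution :: "nat \<Rightarrow> real vec \<Rightarrow> bool" where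
  "positive_distribution n \<mu> \<longleftrightarrow>
     \<mu> \<in> carrier_vec n \<and> (\<forall>i<n. \<mu> $ i > 0) \<and> (\<Sum>i<n. \<mu> $ i) = 1"

definition permutation_matrix :: "nat \<Rightarrow> real mat \<Rightarrow> bool" where
  "permutation_matrix n P \<longleftrightarrow>
     P \<in> carrier_mat n n \<and>
     (\<forall>i<n. \<forall>j<n. P $$ (i, j) = 0 \<or> P $$ (i, j) = 1) \<and>
     (\<forall>i<n. \<exists>!j. j < n \<and> P $$ (i, j) = 1) \<and>
     (\<forall>j<n. \<exists>!i. i < n \<and> P $$ (i, j) = 1)"

end

theory Submission
  imports Defs
begin

text \<open>
  A sorted ratio at position \<open>k\<close> compares the \<open>k\<close>-th smallest entry of \<open>\<mu>\<close> with the \<open>k\<close>-th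
  smallest entry of \<open>\<mu>'\<close>, and these usually sit at different indices. It can nevertheless be
  compared with an unsorted ratio \<open>\<mu>\<^sub>x / \<mu>'\<^sub>x\<close>: by the pigeonhole principle
  (\<open>bijections_straddle\<close>) some index \<open>x\<close> is placed at position \<open>k\<close> or later by the ordering of
  \<open>\<mu>\<close> and at position \<open>k\<close> or earlier by the ordering of \<open>\<mu>'\<close>. For this \<open>x\<close> the numerator
  \<open>\<mu>\<^sub>x\<close> is at least the \<open>k\<close>-th smallest entry and the denominator \<open>\<mu>'\<^sub>x\<close> is at most the
  \<open>k\<close>-th smallest, so the unsorted ratio at \<open>x\<close> is at least the sorted ratio at \<open>k\<close>
  (\<open>sorted_ratio_le\<close>). Exchanging the two orderings gives an unsorted ratio that is at most the
  sorted one (\<open>sorted_ratio_ge\<close>). Hence every sorted ratio lies between the extreme unsorted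
  ratios.
\<close>

lemma permutation_matrix_mult_vec:
  assumes P: "permutation_matrix n P"
  obtains \<sigma> where "bij_betw \<sigma> {..<n} {..<n}"
    and "\<And>v i. v \<in> carrier_vec n \<Longrightarrow> i < n \<Longrightarrow> (P *\<^sub>v v) $ i = v $ \<sigma> i"
proof -
  have car: "P \<in> carrier_mat n n"
    and zero_one: "\<And>i j. i < n \<Longrightarrow> j < n \<Longrightarrow> P $$ (i, j) = 0 \<or> P $$ (i, j) = 1"
    and row: "\<And>i. i < n \<Longrightarrow> \<exists>!j. j < n \<and> P $$ (i, j) = 1"
    and col: "\<And>j. j < n \<Longrightarrow> \<exists>!i. i < n \<and> P $$ (i, j) = 1"
    using P unfolding permutation_matrix_def by auto
  define \<sigma> where "\<sigma> i = (THE j. j < n \<and> P $$ (i, j) = 1)" for i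
  have \<sigma>: "\<sigma> i < n" "P $$ (i, \<sigma> i) = 1" if "i < n" for i
    using theI'[OF row[OF that]] unfolding \<sigma>_def by auto
  have entry: "P $$ (i, j) = (if j = \<sigma> i then 1 else 0)" if "i < n" "j < n" for i j
    using \<sigma> row zero_one that by metis
  have "inj_on \<sigma> {..<n}"
  proof (rule inj_onI)
    fix i j assume "i \<in> {..<n}" "j \<in> {..<n}" "\<sigma> i = \<sigma> j"
    then show "i = j" using \<sigma>[of i] \<sigma>[of j] col[of "\<sigma> i"] by auto
  qed
  moreover have "\<sigma> ` {..<n} \<subseteq> {..<n}" using \<sigma> by auto
  ultimately have "bij_betw \<sigma> {..<n} {..<n}"
    by (simp add: bij_betw_def endo_inj_surj)
  moreover have "(P *\<^sub>v v) $ i = v $ \<sigma> i" if v: "v \<in> carrier_vec n" and i: "i < n" for v i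
  proof -
    have "(P *\<^sub>v v) $ i = (\<Sum>j<n. P $$ (i, j) * v $ j)"
      using car v i by (simp add: scalar_prod_def lessThan_atLeast0)
    also have "\<dots> = (\<Sum>j<n. if j = \<sigma> i then v $ j else 0)"
      using i by (intro sum.cong) (auto simp: entry)
    also have "\<dots> = v $ \<sigma> i" using \<sigma>(1)[OF i] by simp
    finally show ?thesis .
  qed
  ultimately show thesis by (rule that)
qed

text \<open>
  Pigeonhole: the \<open>k + 1\<close> points enumerated by \<open>\<tau>\<close> up to position \<open>k\<close> cannot all be among the
  \<open>k\<close> points that \<open>\<sigma>\<close> enumerates before position \<open>k\<close>.
\<close>

lemma bijections_straddle:
  fixes \<sigma> \<tau> :: "nat \<Rightarrow> 'a"
  assumes \<sigma>: "bij_betw \<sigma> {..<n} S" and \<tau>: "bij_betw \<tau> {..<n} S" and k: "k < n"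
  obtains i j where "i \<le> k" "k \<le> j" "j < n" "\<tau> i = \<sigma> j"
proof -
  have "inj_on \<tau> {..k}"
    using \<tau> k by (auto simp: bij_betw_def intro: inj_on_subset)
  then have "card (\<tau> ` {..k}) = Suc k" by (simp add: card_image)
  moreover have "card (\<sigma> ` {..<k}) \<le> k"
    using card_image_le[of "{..<k}" \<sigma>] by simp
  ultimately have "\<not> \<tau> ` {..k} \<subseteq> \<sigma> ` {..<k}"
    using card_mono[of "\<sigma> ` {..<k}" "\<tau> ` {..k}"] by auto
  then obtain i where i: "i \<le> k" "\<tau> i \<notin> \<sigma> ` {..<k}" by auto
  have "\<tau> i \<in> S" using \<tau> i k by (auto simp: bij_betw_def)
  then obtain j where j: "j < n" "\<tau> i = \<sigma> j"
    using \<sigma> by (auto simp: bij_betw_def)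
  with i have "k \<le> j" by (auto simp: not_less[symmetric])
  with i j show thesis using that by blast
qed

lemma sorted_ratio_le:
  fixes \<sigma> \<tau> :: "nat \<Rightarrow> 'a" and a b :: "'a \<Rightarrow> 'b::linordered_field"
  assumes \<sigma>: "bij_betw \<sigma> {..<n} S" and \<tau>: "bij_betw \<tau> {..<n} S"
    and a: "mono_on {..<n} (a \<circ> \<sigma>)" and b: "mono_on {..<n} (b \<circ> \<tau>)"
    and a_nonneg: "\<And>x. x \<in> S \<Longrightarrow> 0 \<le> a x" and b_pos: "\<And>x. x \<in> S \<Longrightarrow> 0 < b x"
    and k: "k < n"
  obtains x where "x \<in> S" "a (\<sigma> k) / b (\<tau> k) \<le> a x / b x"
proof -
  obtain i j where ij: "i \<le> k" "k \<le> j" "j < n" "\<tau> i = \<sigma> j"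
    using bijections_straddle[OF \<sigma> \<tau> k] .
  have S: "\<sigma> j \<in> S" using \<sigma> ij by (auto simp: bij_betw_def)
  have "a (\<sigma> k) \<le> a (\<sigma> j)" using mono_onD[OF a, of k j] ij k by simp
  moreover have "b (\<sigma> j) \<le> b (\<tau> k)" using mono_onD[OF b, of i k] ij k by simp
  ultimately have "a (\<sigma> k) / b (\<tau> k) \<le> a (\<sigma> j) / b (\<sigma> j)"
    using a_nonneg[OF S] b_pos[OF S] by (intro frac_le)
  with S show thesis by (rule that)
qed

lemma sorted_ratio_ge:
  fixes \<sigma> \<tau> :: "nat \<Rightarrow> 'a" and a b :: "'a \<Rightarrow> 'b::linordered_field"
  assumes \<sigma>: "bij_betw \<sigma> {..<n} S" and \<tau>: "bij_betw \<tau> {..<n} S"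
    and a: "mono_on {..<n} (a \<circ> \<sigma>)" and b: "mono_on {..<n} (b \<circ> \<tau>)"
    and a_nonneg: "\<And>x. x \<in> S \<Longrightarrow> 0 \<le> a x" and b_pos: "\<And>x. x \<in> S \<Longrightarrow> 0 < b x"
    and k: "k < n"
  obtains x where "x \<in> S" "a x / b x \<le> a (\<sigma> k) / b (\<tau> k)"
proof -
  obtain i j where ij: "i \<le> k" "k \<le> j" "j < n" "\<sigma> i = \<tau> j"
    using bijections_straddle[OF \<tau> \<sigma> k] .
  have S: "\<tau> j \<in> S" "\<sigma> k \<in> S" "\<tau> k \<in> S"
    using \<sigma> \<tau> ij k by (auto simp: bij_betw_def)
  have "a (\<tau> j) \<le> a (\<sigma> k)" using mono_onD[OF a, of i k] ij k by simp
  moreover have "b (\<tau> k) \<le> b (\<tau> j)" using mono_onD[OF b, of k j] ij k by simp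
  ultimately have "a (\<tau> j) / b (\<tau> j) \<le> a (\<sigma> k) / b (\<tau> k)"
    using a_nonneg[OF S(2)] b_pos[OF S(3)] by (intro frac_le)
  with S(1) show thesis by (rule that)
qed

theorem theorem2p10:
  fixes n :: nat and \<mu> \<mu>' :: "real vec" and P P' :: "real mat"
  assumes "positive_distribution n \<mu>" and "positive_distribution n \<mu>'"
    and "permutation_matrix n P" and "permutation_matrix n P'"
    and "mono_on {..<n} (\<lambda>i. (P *\<^sub>v \<mu>) $ i)"
    and "mono_on {..<n} (\<lambda>i. (P' *\<^sub>v \<mu>') $ i)"
  shows "{(MIN i\<in>{..<n}. (P *\<^sub>v \<mu>) $ i / (P' *\<^sub>v \<mu>') $ i) ..
          (MAX i\<in>{..<n}. (P *\<^sub>v \<mu>) $ i / (P' *\<^sub>v \<mu>') $ i)}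
       \<subseteq> {(MIN i\<in>{..<n}. \<mu> $ i / \<mu>' $ i) .. (MAX i\<in>{..<n}. \<mu> $ i / \<mu>' $ i)}"
proof -
  have \<mu>: "\<mu> \<in> carrier_vec n" "\<And>i. i < n \<Longrightarrow> 0 < \<mu> $ i"
    and \<mu>': "\<mu>' \<in> carrier_vec n" "\<And>i. i < n \<Longrightarrow> 0 < \<mu>' $ i"
    and total: "(\<Sum>i<n. \<mu> $ i) = 1"
    using assms(1,2) unfolding positive_distribution_def by auto
  \<comment> \<open>An empty vector would have total mass zero, so the minima and maxima range over a
    nonempty set.\<close>
  have n: "{..<n} \<noteq> {}"
  proof
    assume "{..<n} = {}"
    with total show False by simp
  qed
  obtain \<sigma> where \<sigma>: "bij_betw \<sigma> {..<n} {..<n}"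
    and P: "\<And>v i. v \<in> carrier_vec n \<Longrightarrow> i < n \<Longrightarrow> (P *\<^sub>v v) $ i = v $ \<sigma> i"
    using permutation_matrix_mult_vec[OF assms(3)] by blast
  obtain \<tau> where \<tau>: "bij_betw \<tau> {..<n} {..<n}"
    and P': "\<And>v i. v \<in> carrier_vec n \<Longrightarrow> i < n \<Longrightarrow> (P' *\<^sub>v v) $ i = v $ \<tau> i"
    using permutation_matrix_mult_vec[OF assms(4)] by blast
  have a: "mono_on {..<n} ((\<lambda>x. \<mu> $ x) \<circ> \<sigma>)"
    using assms(5) P[OF \<mu>(1)] by (simp add: monotone_on_def)
  have b: "mono_on {..<n} ((\<lambda>x. \<mu>' $ x) \<circ> \<tau>)"
    using assms(6) P'[OF \<mu>'(1)] by (simp add: monotone_on_def)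
  have nonneg: "\<And>x. x \<in> {..<n} \<Longrightarrow> 0 \<le> \<mu> $ x" and pos: "\<And>x. x \<in> {..<n} \<Longrightarrow> 0 < \<mu>' $ x"
    using \<mu>(2) \<mu>'(2) by (auto intro: less_imp_le)
  have sorted_ratio: "(P *\<^sub>v \<mu>) $ k / (P' *\<^sub>v \<mu>') $ k = \<mu> $ \<sigma> k / \<mu>' $ \<tau> k" if "k < n" for k
    using P[OF \<mu>(1) that] P'[OF \<mu>'(1) that] by simp
  have upper: "(P *\<^sub>v \<mu>) $ k / (P' *\<^sub>v \<mu>') $ k \<le> (MAX i\<in>{..<n}. \<mu> $ i / \<mu>' $ i)"
    if k: "k < n" for k
  proof -
    obtain x where "x \<in> {..<n}" "\<mu> $ \<sigma> k / \<mu>' $ \<tau> k \<le> \<mu> $ x / \<mu>' $ x"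
      using sorted_ratio_le[OF \<sigma> \<tau> a b nonneg pos k] .
    moreover from this(1) have "\<mu> $ x / \<mu>' $ x \<le> (MAX i\<in>{..<n}. \<mu> $ i / \<mu>' $ i)"
      by (intro Max_ge) auto
    ultimately show ?thesis unfolding sorted_ratio[OF k] by linarith
  qed
  have lower: "(MIN i\<in>{..<n}. \<mu> $ i / \<mu>' $ i) \<le> (P *\<^sub>v \<mu>) $ k / (P' *\<^sub>v \<mu>') $ k"
    if k: "k < n" for k
  proof -
    obtain x where "x \<in> {..<n}" "\<mu> $ x / \<mu>' $ x \<le> \<mu> $ \<sigma> k / \<mu>' $ \<tau> k"
      using sorted_ratio_ge[OF \<sigma> \<tau> a b nonneg pos k] .
    moreover from this(1) have "(MIN i\<in>{..<n}. \<mu> $ i / \<mu>' $ i) \<le> \<mu> $ x / \<mu>' $ x"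
      by (intro Min_le) auto
    ultimately show ?thesis unfolding sorted_ratio[OF k] by linarith
  qed
  have "(MIN i\<in>{..<n}. \<mu> $ i / \<mu>' $ i) \<le> (MIN i\<in>{..<n}. (P *\<^sub>v \<mu>) $ i / (P' *\<^sub>v \<mu>') $ i)"
    using n lower by (intro Min.boundedI) auto
  moreover have "(MAX i\<in>{..<n}. (P *\<^sub>v \<mu>) $ i / (P' *\<^sub>v \<mu>') $ i) \<le> (MAX i\<in>{..<n}. \<mu> $ i / \<mu>' $ i)"
    using n upper by (intro Max.boundedI) auto
  ultimately show ?thesis by auto
qed

end
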